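(* $f(n,3,4)\ge (1-o(1))(n/3)^{1/5}$, where the $o(1)$ term tends to $0$ as $n\to\infty$.
   Context: A $3$-digraph $G$ consists of a finite vertex set $V(G)$ and an edge set $E(G)$ whose elements are ordered triples of distinct vertices. A $(3,k)$-tournament is a $3$-digraph $G$ such that for every $3$-element set $S\subseteq V(G)$, exactly $k$ of the $6$ orderings of $S$ are edges of $G$. The tight path $P^{(3)}_s$ is the $3$-digraph with $s$ distinct vertices $v_1,\ldots,v_s$ whose edges are exactly the triples $(v_i,v_{i+1},v_{i+2})$, $1\le i\le s-2$ (no edges if $s<3$). A $3$-digraph $G$ contains $P^{(3)}_s$ if there is an injection of its vertices into $V(G)$ mapping edges to edges. $f(n,3,k)$ is the maximum integer $s$ such that every $n$-vertex $(3,k)$-tournament contains a copy of $P^{(3)}_s$. *)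

theory Defs
  imports Complex_Main
begin

record 'a digraph3 =
  verts :: "'a set"
  edges :: "('a \<times> 'a \<times> 'a) set"

definition is_digraph3 :: "'a digraph3 \<Rightarrow> bool" where
  "is_digraph3 G \<longleftrightarrow>
     finite (verts G) \<and>
     (\<forall>(x, y, z) \<in> edges G. {x, y, z} \<subseteq> verts G \<and> distinct [x, y, z])"

definition orderings3 :: "'a set \<Rightarrow> ('a \<times> 'a \<times> 'a) set" where
  "orderings3 S = {(x, y, z). distinct [x, y, z] \<and> {x, y, z} = S}"

definition tournament3 :: "nat \<Rightarrow> 'a digraph3 \<Rightarrow> bool" where
  "tournament3 k G \<longleftrightarrow>
     is_digraph3 G \<and>
     (\<forall>S \<subseteq> verts G. card S = 3 \<longrightarrow> card (edges G \<inter> orderings3 S) = k)"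

definition tight_path3 :: "nat \<Rightarrow> nat digraph3" where
  "tight_path3 s = \<lparr>verts = {1..s}, edges = {(i, i + 1, i + 2) |i. 1 \<le> i \<and> i + 2 \<le> s}\<rparr>"

definition contains3 :: "'a digraph3 \<Rightarrow> 'b digraph3 \<Rightarrow> bool" where
  "contains3 G H \<longleftrightarrow>
     (\<exists>\<phi>. inj_on \<phi> (verts H) \<and> \<phi> ` verts H \<subseteq> verts G \<and>
          (\<forall>(x, y, z) \<in> edges H. (\<phi> x, \<phi> y, \<phi> z) \<in> edges G))"

text \<open>
  Taking vertices in \<^typ>\<open>nat\<close> loses no generality: vertex sets are finite and containment is
  invariant under isomorphism.  For \<open>k \<le> 6\<close> a \<open>(3,k)\<close>-tournament on \<open>n\<close> vertices exists, so the
  set below is a subset of \<open>{..n}\<close>; it always contains \<open>0\<close>, hence the maximum is well defined.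
\<close>

definition f3 :: "nat \<Rightarrow> nat \<Rightarrow> nat" where
  "f3 n k = Max {s. \<forall>G :: nat digraph3.
     tournament3 k G \<and> card (verts G) = n \<longrightarrow> contains3 G (tight_path3 s)}"

end

theory Submission
  imports Defs "HOL-Real_Asymp.Real_Asymp"
begin

text \<open>
  Suppose \<open>G\<close> has no tight path on \<open>m\<close> vertices, and let \<open>F x y < m\<close> measure the longest tight path
  ending in \<open>(x, y)\<close>.  Along an edge \<open>(x, y, z)\<close> with \<open>z\<close> off the chosen path for \<open>(x, y)\<close> we have
  \<open>F x y < F y z\<close>.  Hence, apart from at most \<open>m\<close> exceptional \<open>z\<close> per pair \<open>(x, y)\<close>, no cyclic class
  of a triple consists of three edges; as four orderings are edges, each of the two cyclic classes
  has exactly two, which says that \<open>F x y, F y z, F z x\<close> are in cyclic order.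

  Read colors as points on a circle and let \<open>K x y\<close> be the arc from \<open>F x y\<close> to \<open>F y x\<close>.  In each
  non-exceptional triple some vertex \<open>x\<close> is a center: \<open>K x y\<close> and \<open>K x z\<close> are disjoint.  If many arcs at
  \<open>x\<close> lie in a window of \<open>w\<close> colors and share a point, their endpoints again form such a system, with
  only the \<open>w\<close> colors of the window.  So, by induction, the number of arcs at \<open>x\<close> inside a window
  of \<open>w\<close> colors is \<open>O(w\<^sup>q)\<close> with \<open>q = 39/10\<close>.  This bounds the number of short arcs and, for a given
  \<open>K x y\<close>, the number of arcs at \<open>x\<close> disjoint from it.  Since \<open>K x y\<close> and \<open>K y x\<close> have
  complementary lengths, too few centered triples would arise from a system on more than
  \<open>O(m log m \<sqdot> m\<^sup>q)\<close> vertices, and this is \<open>o(m\<^sup>5)\<close>.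
\<close>

subsection \<open>Cyclic order on colors\<close>

definition cw :: "nat \<Rightarrow> nat \<Rightarrow> nat \<Rightarrow> bool" where
  "cw a b c \<longleftrightarrow> a < b \<and> b < c \<or> b < c \<and> c < a \<or> c < a \<and> a < b"

text \<open>Disjointness of the closed upward arcs from \<open>a\<close> to \<open>b\<close> and
  from \<open>c\<close> to \<open>d\<close> on the circle; the four disjuncts are the places where
  the circle may be cut open. An arc with \<open>a = b\<close> is a single point.\<close>

definition disjoint_arcs :: "nat \<Rightarrow> nat \<Rightarrow> nat \<Rightarrow> nat \<Rightarrow> bool" where
  "disjoint_arcs a b c d \<longleftrightarrow>
     a \<le> b \<and> b < c \<and> c \<le> d \<or> b < c \<and> c \<le> d \<and> d < a \<or>
     c \<le> d \<and> d < a \<and> a \<le> b \<or> d < a \<and> a \<le> b \<and> b < c"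

text \<open>This is \<open>a - c\<close> modulo \<open>k\<close>, the coordinate of \<open>a\<close>
  once the origin is moved to \<open>c\<close>. Hence \<open>rot k a b\<close> is also the length of
  the arc from \<open>a\<close> to \<open>b\<close>.\<close>

definition rot :: "nat \<Rightarrow> nat \<Rightarrow> nat \<Rightarrow> nat" where
  "rot k c a = (if c \<le> a then a - c else a + k - c)"

lemma rot_less: "a < k \<Longrightarrow> c < k \<Longrightarrow> rot k c a < k"
  by (auto simp: rot_def)

lemma cw_rot:
  assumes "cw a b d" "a < k" "b < k" "d < k" "c < k"
  shows "cw (rot k c a) (rot k c b) (rot k c d)"
  using assms(1) unfolding cw_def
proof (elim disjE)
qed (use assms(2-5) in \<open>cases "c \<le> a"; cases "c \<le> b"; cases "c \<le> d"; auto simp: rot_def cw_def\<close>)+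

text \<open>On the real circle, \<open>x\<close> is a center when the closed arc from
  \<open>yx\<close> to \<open>xz\<close> misses the open arc from \<open>zx\<close> to
  \<open>xy\<close>; for \<open>y\<close> the arcs are \<open>zy\<close> to \<open>yx\<close> and
  \<open>xy\<close> to \<open>yz\<close>, for \<open>z\<close> they are \<open>xz\<close> to
  \<open>zy\<close> and \<open>yz\<close> to \<open>zx\<close>. If all three pairs met, a common
  point chosen for each vertex would give three points that the closed arcs order one way around and
  the open arcs the opposite way.\<close>

lemma center_exists:
  assumes "cw xy yz zx" "cw xz zy yx"
  shows "disjoint_arcs xy yx xz zx \<or> disjoint_arcs yz zy yx xy \<or> disjoint_arcs zx xz zy yz"
proof (cases "xy \<le> yx")
  case True
  then show ?thesis
    using assms unfolding cw_def disjoint_arcs_def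
    by (cases "yz \<le> zy") (elim disjE conjE; auto)+
next
  case False
  then show ?thesis
    using assms unfolding cw_def disjoint_arcs_def
    by (cases "yz \<le> zy") (elim disjE conjE; auto)+
qed

text \<open>The complement of the arc from \<open>a\<close> to \<open>b\<close> starts at
  \<open>e\<close> and has \<open>k - 1 - rot k a b\<close> colors; an arc inside it does not wrap
  around when read from \<open>e\<close>.\<close>

lemma disjoint_arcs_rot:
  assumes "disjoint_arcs a b c d" "a < k" "b < k" "c < k" "d < k"
  defines "e \<equiv> (if b + 1 = k then 0 else b + 1)"
  shows "rot k e c \<le> rot k e d \<and> rot k e d < k - 1 - rot k a b"
  using assms(1) unfolding disjoint_arcs_def
proof (elim disjE)
qed (use assms(2-5) in \<open>cases "b + 1 = k"; simp add: e_def rot_def; linarith\<close>)+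

lemma rot_swap:
  assumes "a < k" "b < k"
  shows "rot k b a = (if rot k a b = 0 then 0 else k - rot k a b)"
  using assms by (auto simp: rot_def)

lemma rot_shift:
  assumes "a < k" "c < k" "m < k" "m < rot k c a"
  defines "e \<equiv> (if c + m + 1 < k then c + m + 1 else c + m + 1 - k)"
  shows "rot k e a = rot k c a - (m + 1)" "e < k"
  using assms unfolding rot_def
  by (cases "c \<le> a"; cases "c + m + 1 < k"; simp; linarith)+

text \<open>Placing the origin \<open>i\<close> steps before \<open>b\<close> produces the different
  windows that contain one given arc.\<close>

lemma rot_back:
  assumes "b < k" "a < k" "i + rot k b a < k"
  defines "c \<equiv> (if i \<le> b then b - i else b + k - i)"
  shows "c < k" "rot k c b = i" "rot k c a = i + rot k b a"
proof -
  show "c < k" using assms(1,3) by (auto simp: c_def)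
  show "rot k c b = i" using assms(1,3) by (auto simp: c_def rot_def)
  show "rot k c a = i + rot k b a"
  proof (cases "b \<le> a")
    case True
    then show ?thesis using assms(1-3) by (cases "i \<le> b") (auto simp: c_def rot_def)
  next
    case False
    then show ?thesis using assms(1-3) by (cases "i \<le> b") (auto simp: c_def rot_def)
  qed
qed

lemma sum_of_bool_card:
  "finite A \<Longrightarrow> (\<Sum>z\<in>A. of_bool (P z)) = card {z \<in> A. P z}"
  by (simp add: sum_of_bool_eq Int_def)

text \<open>Tenth powers turn estimates with exponent 39/10 into comparisons of rational numbers
  that can be evaluated.\<close>

lemma powr_39_10_le:
  fixes r b :: real
  assumes "0 < r" "0 < b" "r ^ 39 \<le> b ^ 10"
  shows "r powr (39 / 10) \<le> b"
proof -
  have "(r powr (39 / 10)) ^ 10 = r ^ 39"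
    using assms(1) by (simp add: powr_power powr_numeral)
  then have "(r powr (39 / 10)) ^ 10 \<le> b ^ 10" using assms(3) by simp
  then show ?thesis by (rule power_le_imp_le_base[of _ 9, simplified]) (use assms in auto)
qed

subsection \<open>Colorings with few exceptional triples\<close>

text \<open>In the application \<open>X x y z\<close> says that \<open>z\<close> lies on the path
  chosen for the ordered pair \<open>(x, y)\<close>, and \<open>s\<close> is the bound on path
  lengths.\<close>

locale sparse_exceptions =
  fixes X :: "'a \<Rightarrow> 'a \<Rightarrow> 'a \<Rightarrow> bool" and s :: nat
  assumes finite_X: "finite {z. X x y z}"
    and card_X: "card {z. X x y z} \<le> s"
begin

definition bad :: "'a \<Rightarrow> 'a \<Rightarrow> 'a \<Rightarrow> bool" where
  "bad x y z \<longleftrightarrow> X x y z \<or> X y x z \<or> X x z y \<or> X z x y \<or> X y z x \<or> X z y x"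

lemma bad_swap: "bad y x z \<longleftrightarrow> bad x y z" "bad x z y \<longleftrightarrow> bad x y z"
  by (auto simp: bad_def)

lemma sum_card_bad_le:
  assumes "finite A"
  shows "(\<Sum>x\<in>A. \<Sum>y\<in>A. card {z \<in> A. bad x y z}) \<le> 6 * s * card A ^ 2"
proof -
  define c where "c P = (\<Sum>x\<in>A. \<Sum>y\<in>A. \<Sum>z\<in>A. of_bool (P x y z) :: nat)"
    for P :: "'a \<Rightarrow> 'a \<Rightarrow> 'a \<Rightarrow> bool"
  have swap12: "c (\<lambda>x y z. P y x z) = c P" for P
    unfolding c_def by (rule sum.swap)
  have swap23: "c (\<lambda>x y z. P x z y) = c P" for P
    unfolding c_def
  proof (rule sum.cong[OF refl])
    show "(\<Sum>y\<in>A. \<Sum>z\<in>A. (of_bool (P x z y) :: nat)) = (\<Sum>y\<in>A. \<Sum>z\<in>A. of_bool (P x y z))" for x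
      by (rule sum.swap)
  qed
  have inner: "(\<Sum>z\<in>A. of_bool (X x y z)) \<le> s" for x y
  proof -
    have "card {z \<in> A. X x y z} \<le> card {z. X x y z}"
      by (intro card_mono finite_X) auto
    then show ?thesis using card_X[of x y] sum_of_bool_card[OF assms, of "X x y"] by linarith
  qed
  have "c X \<le> (\<Sum>x\<in>A. \<Sum>y\<in>A. s)"
    unfolding c_def by (intro sum_mono inner)
  then have cX: "c X \<le> s * card A ^ 2"
    by (simp add: power2_eq_square algebra_simps)
  have "(\<Sum>x\<in>A. \<Sum>y\<in>A. card {z \<in> A. bad x y z}) = c bad"
    unfolding c_def by (simp only: sum_of_bool_card[OF assms])
  moreover have "c bad \<le> c X + c (\<lambda>x y z. X y x z) + c (\<lambda>x y z. X x z y) + c (\<lambda>x y z. X z x y)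
      + c (\<lambda>x y z. X y z x) + c (\<lambda>x y z. X z y x)"
  proof -
    have "of_bool (bad x y z) \<le> (of_bool (X x y z) + of_bool (X y x z) + of_bool (X x z y)
        + of_bool (X z x y) + of_bool (X y z x) + of_bool (X z y x) :: nat)" for x y z
      by (auto simp: bad_def of_bool_def)
    then have "c bad \<le> (\<Sum>x\<in>A. \<Sum>y\<in>A. \<Sum>z\<in>A. of_bool (X x y z) + of_bool (X y x z) + of_bool (X x z y)
        + of_bool (X z x y) + of_bool (X y z x) + of_bool (X z y x))"
      unfolding c_def by (intro sum_mono)
    then show ?thesis by (simp only: c_def sum.distrib)
  qed
  moreover have "c (\<lambda>x y z. X y x z) = c X" by (rule swap12)
  moreover have "c (\<lambda>x y z. X x z y) = c X" by (rule swap23)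
  moreover have "c (\<lambda>x y z. X z x y) = c (\<lambda>x y z. X y x z)"
    by (rule swap23[of "\<lambda>x y z. X y x z"])
  moreover have "c (\<lambda>x y z. X y z x) = c (\<lambda>x y z. X x z y)"
    by (rule swap12[of "\<lambda>x y z. X x z y"])
  moreover have "c (\<lambda>x y z. X z y x) = c (\<lambda>x y z. X z x y)"
    by (rule swap12[of "\<lambda>x y z. X z x y"])
  ultimately show ?thesis using cX by linarith
qed

text \<open>A value of at least \<open>k\<close> marks an ordered pair as uncolored, and
  \<open>D\<close> is the number of such defects tolerated at a vertex. This slack makes the notion
  inheritable by subsets with fewer colors. The reversed cyclic class is covered as well, by
  exchanging two of the quantified vertices.\<close>

definition colored :: "'a set \<Rightarrow> ('a \<Rightarrow> 'a \<Rightarrow> nat) \<Rightarrow> nat \<Rightarrow> nat \<Rightarrow> bool" where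
  "colored A F k D \<longleftrightarrow> finite A \<and>
     (\<forall>x\<in>A. card {y \<in> A. y \<noteq> x \<and> \<not> (F x y < k \<and> F y x < k)} \<le> D) \<and>
     (\<forall>x\<in>A. \<forall>y\<in>A. \<forall>z\<in>A. x \<noteq> y \<and> y \<noteq> z \<and> x \<noteq> z \<and> \<not> bad x y z \<and>
        F x y < k \<and> F y x < k \<and> F y z < k \<and> F z y < k \<and> F x z < k \<and> F z x < k \<longrightarrow>
        cw (F x y) (F y z) (F z x))"

text \<open>The threshold \<open>10000 * s\<close> balances two needs: only a fraction 6/10000 of
  all pairs can exceed it, and passing to neighbors of \<open>x\<close> raises \<open>D\<close> by
  no more than this amount.\<close>

definition ok :: "'a set \<Rightarrow> ('a \<Rightarrow> 'a \<Rightarrow> nat) \<Rightarrow> nat \<Rightarrow> 'a \<Rightarrow> 'a \<Rightarrow> bool" where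
  "ok A F k x y \<longleftrightarrow> x \<in> A \<and> y \<in> A \<and> x \<noteq> y \<and> F x y < k \<and> F y x < k \<and>
     card {z \<in> A. bad x y z} \<le> 10000 * s"

lemma ok_sym: "ok A F k x y \<longleftrightarrow> ok A F k y x"
  unfolding ok_def by (auto simp: bad_swap)

lemma coloredD:
  assumes "colored A F k D"
  shows "finite A"
    and "x \<in> A \<Longrightarrow> card {y \<in> A. y \<noteq> x \<and> \<not> (F x y < k \<and> F y x < k)} \<le> D"
    and "\<lbrakk>x \<in> A; y \<in> A; z \<in> A; x \<noteq> y; y \<noteq> z; x \<noteq> z; \<not> bad x y z; F x y < k; F y x < k;
          F y z < k; F z y < k; F x z < k; F z x < k\<rbrakk> \<Longrightarrow> cw (F x y) (F y z) (F z x)"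
  using assms unfolding colored_def by (auto simp: Ball_def)

text \<open>For \<open>u\<close>, \<open>v\<close> in \<open>S\<close> with \<open>x, u, v\<close>
  not bad, the color \<open>F u v\<close> lies strictly inside the arc from \<open>F x u\<close> to
  \<open>F v x\<close>. If \<open>cond\<close> confines these arcs to \<open>w\<close> colors, then
  \<open>S\<close> needs only these colors. New defects at \<open>u\<close> come from the
  \<open>v\<close> that are bad with \<open>x\<close> and \<open>u\<close>; pairs uncolored before
  keep their large value.\<close>

lemma colored_restrict:
  assumes col: "colored A F k D" and x: "x \<in> A" and S: "\<And>u. u \<in> S \<Longrightarrow> ok A F k x u"
    and c: "c < k" and w: "w \<le> k"
    and cond: "\<And>u v r. \<lbrakk>u \<in> S; v \<in> S; u \<noteq> v; r < k; cw (F x u) r (F v x)\<rbrakk> \<Longrightarrow> rot k c r < w"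
  shows "colored S (\<lambda>u v. if F u v < k then rot k c (F u v) else F u v) w (D + 10000 * s)"
    (is "colored S ?F w _")
proof -
  note fin = coloredD(1)[OF col]
  have SA: "S \<subseteq> A" using S by (auto simp: ok_def)
  have small: "F u v < k" if "?F u v < w" for u v
    using that w by (auto split: if_splits)
  have viol: "card {v \<in> S. v \<noteq> u \<and> \<not> (?F u v < w \<and> ?F v u < w)} \<le> D + 10000 * s" if u: "u \<in> S" for u
  proof -
    let ?V = "{v \<in> A. v \<noteq> u \<and> \<not> (F u v < k \<and> F v u < k)}"
    have "{v \<in> S. v \<noteq> u \<and> \<not> (?F u v < w \<and> ?F v u < w)} \<subseteq> ?V \<union> {v \<in> A. bad x u v}"
    proof (rule subsetI, rule ccontr)
      fix v assume v: "v \<in> {v \<in> S. v \<noteq> u \<and> \<not> (?F u v < w \<and> ?F v u < w)}"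
        and nv: "v \<notin> ?V \<union> {v \<in> A. bad x u v}"
      have vS: "v \<in> S" and vu: "v \<noteq> u" and vA: "v \<in> A" using v SA by auto
      have F: "F u v < k" "F v u < k" "\<not> bad x u v" using nv vA vu by auto
      have oku: "ok A F k x u" and okv: "ok A F k x v" using S u vS by auto
      have "cw (F x u) (F u v) (F v x)"
        by (rule coloredD(3)[OF col]) (use oku okv F vu in \<open>auto simp: ok_def\<close>)
      then have 1: "rot k c (F u v) < w" using cond[OF u vS] F vu by auto
      have "cw (F x v) (F v u) (F u x)"
        by (rule coloredD(3)[OF col]) (use oku okv F vu in \<open>auto simp: ok_def bad_swap\<close>)
      then have 2: "rot k c (F v u) < w" using cond[OF vS u] F vu by auto
      show False using v 1 2 F by auto
    qed
    then have "card {v \<in> S. v \<noteq> u \<and> \<not> (?F u v < w \<and> ?F v u < w)} \<le> card (?V \<union> {v \<in> A. bad x u v})"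
      by (intro card_mono) (use fin in auto)
    also have "\<dots> \<le> card ?V + card {v \<in> A. bad x u v}" by (rule card_Un_le)
    also have "\<dots> \<le> D + 10000 * s"
      using coloredD(2)[OF col, of u] S[OF u] by (auto simp: ok_def intro: add_mono)
    finally show ?thesis .
  qed
  show ?thesis
    unfolding colored_def
  proof (intro conjI ballI impI)
    show "finite S" using fin SA finite_subset by blast
    show "card {y \<in> S. y \<noteq> u \<and> \<not> (?F u y < w \<and> ?F y u < w)} \<le> D + 10000 * s" if "u \<in> S" for u
      using viol[OF that] .
    fix u v t
    assume "u \<in> S" "v \<in> S" "t \<in> S"
      and h: "u \<noteq> v \<and> v \<noteq> t \<and> u \<noteq> t \<and> \<not> bad u v t \<and> ?F u v < w \<and> ?F v u < w \<and>
        ?F v t < w \<and> ?F t v < w \<and> ?F u t < w \<and> ?F t u < w"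
    have F: "F u v < k" "F v u < k" "F v t < k" "F t v < k" "F u t < k" "F t u < k"
      using h small by blast+
    have "cw (F u v) (F v t) (F t u)"
      by (rule coloredD(3)[OF col]) (use \<open>u \<in> S\<close> \<open>v \<in> S\<close> \<open>t \<in> S\<close> SA h F in auto)
    then have "cw (rot k c (F u v)) (rot k c (F v t)) (rot k c (F t u))"
      using F c by (intro cw_rot)
    then show "cw (?F u v) (?F v t) (?F t u)" using F by simp
  qed
qed

section \<open>Arcs at a vertex: windows and short arcs\<close>

definition win :: "'a set \<Rightarrow> ('a \<Rightarrow> 'a \<Rightarrow> nat) \<Rightarrow> nat \<Rightarrow> 'a \<Rightarrow> nat \<Rightarrow> nat \<Rightarrow> 'a set" where
  "win A F k x c w = {y. ok A F k x y \<and> rot k c (F x y) \<le> rot k c (F y x) \<and> rot k c (F y x) < w}"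

lemma finite_win: "finite A \<Longrightarrow> finite (win A F k x c w)"
  by (rule finite_subset[of _ A]) (auto simp: win_def ok_def)

text \<open>Cut the window at its middle color \<open>m\<close>. Arcs through \<open>m\<close> have
  endpoints forming a coloring with \<open>w\<close> colors, bounded by \<open>B w\<close>; the
  other arcs lie in one of two half windows. The hypothesis on \<open>g\<close> is exactly what
  closes this recursion.\<close>

lemma card_win_le:
  fixes B :: "nat \<Rightarrow> real" and g :: real
  assumes col: "colored A F k D" and x: "x \<in> A" and Wk: "W \<le> k"
    and IH: "\<And>S F' w. \<lbrakk>1 \<le> w; w \<le> W; colored S F' w (D + 10000 * s)\<rbrakk> \<Longrightarrow> real (card S) \<le> B w"
    and B0: "0 \<le> g * B 0"
    and B: "\<And>w i j. \<lbrakk>1 \<le> w; i \<le> w div 2; j \<le> w div 2\<rbrakk> \<Longrightarrow> B w + g * B i + g * B j \<le> g * B w"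
  shows "\<lbrakk>c < k; w \<le> W\<rbrakk> \<Longrightarrow> real (card (win A F k x c w)) \<le> g * B w"
proof (induction w arbitrary: c rule: less_induct)
  case (less w)
  note fin = coloredD(1)[OF col]
  show ?case
  proof (cases "w = 0")
    case True
    then show ?thesis using B0 by (simp add: win_def)
  next
    case False
    define m where "m = w div 2"
    have mw: "m < w" "w - m - 1 \<le> w div 2" using False by (auto simp: m_def)
    have mk: "m < k" using mw less.prems Wk by simp
    define e where "e = (if c + m + 1 < k then c + m + 1 else c + m + 1 - k)"
    have ek: "e < k" using less.prems mk by (auto simp: e_def)
    define S where "S = {y \<in> win A F k x c w. rot k c (F x y) \<le> m \<and> m \<le> rot k c (F y x)}"
    have okS: "ok A F k x u" if "u \<in> S" for u using that by (auto simp: S_def win_def)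
    have "colored S (\<lambda>u v. if F u v < k then rot k c (F u v) else F u v) w (D + 10000 * s)"
    proof (rule colored_restrict[OF col x okS])
      show "c < k" "w \<le> k" using less.prems Wk by auto
      \<comment> \<open>As the coordinates satisfy \<open>F x u\<close> \<le> \<open>m\<close> \<le>
        \<open>F v x\<close>, the arc from \<open>F x u\<close> to \<open>F v x\<close> stays inside
        the window, also for different \<open>u\<close> and \<open>v\<close>.\<close>
      fix u v r assume uv: "u \<in> S" "v \<in> S" "r < k" "cw (F x u) r (F v x)"
      have "cw (rot k c (F x u)) (rot k c r) (rot k c (F v x))"
        using uv okS less.prems by (intro cw_rot) (auto simp: ok_def)
      then show "rot k c r < w" using uv by (auto simp: S_def win_def cw_def)
    qed
    then have S: "real (card S) \<le> B w" using IH less.prems False by auto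
    have L: "real (card (win A F k x c m)) \<le> g * B m"
      using less.IH[of m c] mw less.prems by auto
    have R: "real (card (win A F k x e (w - m - 1))) \<le> g * B (w - m - 1)"
      using less.IH[of "w - m - 1" e] ek less.prems False by auto
    have "win A F k x c w \<subseteq> S \<union> win A F k x c m \<union> win A F k x e (w - m - 1)"
    proof
      fix y assume y: "y \<in> win A F k x c w"
      show "y \<in> S \<union> win A F k x c m \<union> win A F k x e (w - m - 1)"
      proof (cases "rot k c (F x y) \<le> m")
        case True
        then show ?thesis using y by (cases "m \<le> rot k c (F y x)") (auto simp: S_def win_def)
      next
        case gt: False
        have le: "rot k c (F x y) \<le> rot k c (F y x)" "rot k c (F y x) < w" "ok A F k x y"
          using y by (auto simp: win_def)
        have "rot k e (F x y) = rot k c (F x y) - (m + 1)"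
          unfolding e_def by (rule rot_shift) (use le gt less.prems mk in \<open>auto simp: ok_def\<close>)
        moreover have "rot k e (F y x) = rot k c (F y x) - (m + 1)"
          unfolding e_def by (rule rot_shift) (use le gt less.prems mk in \<open>auto simp: ok_def\<close>)
        ultimately have "y \<in> win A F k x e (w - m - 1)" using le gt by (auto simp: win_def)
        then show ?thesis by simp
      qed
    qed
    then have "card (win A F k x c w) \<le> card (S \<union> win A F k x c m \<union> win A F k x e (w - m - 1))"
      by (intro card_mono) (use fin finite_win S_def in auto)
    also have "\<dots> \<le> card S + card (win A F k x c m) + card (win A F k x e (w - m - 1))"
      by (meson add_right_mono card_Un_le le_trans)
    finally have "real (card (win A F k x c w)) \<le> B w + g * B m + g * B (w - m - 1)"
      using S L R by linarith
    also have "\<dots> \<le> g * B w" using B[of w m "w - m - 1"] mw False by (auto simp: m_def)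
    finally show ?thesis .
  qed
qed

text \<open>Double counting of pairs (arc, window containing it): an arc of length at most
  \<open>l\<close> has at most \<open>l + 1\<close> colors, so at least \<open>w - l\<close> of the
  \<open>k\<close> windows of size \<open>w\<close> contain it.\<close>

lemma card_short_arcs_le:
  fixes b :: real
  assumes fin: "finite A" and wk: "w \<le> k" and l: "l < w"
    and b: "\<And>c. c < k \<Longrightarrow> real (card (win A F k x c w)) \<le> b"
  shows "real (card {y. ok A F k x y \<and> rot k (F x y) (F y x) \<le> l}) * real (w - l) \<le> real k * b"
proof -
  define T where "T = {y. ok A F k x y \<and> rot k (F x y) (F y x) \<le> l}"
  have TA: "T \<subseteq> A" by (auto simp: T_def ok_def)
  have each: "w - l \<le> card {c \<in> {..<k}. y \<in> win A F k x c w}" if y: "y \<in> T" for y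
  proof -
    define b where "b = F x y"
    define h where "h i = (if i \<le> b then b - i else b + k - i)" for i
    have ok: "ok A F k x y" and len: "rot k b (F y x) \<le> l" using y by (auto simp: T_def b_def)
    have h: "h i < k" "rot k (h i) b = i" "rot k (h i) (F y x) = i + rot k b (F y x)" if "i < w - l" for i
      unfolding h_def using rot_back[of b k "F y x" i] ok len that wk by (auto simp: ok_def b_def)
    have "inj_on h {..<w - l}" by (rule inj_onI) (metis h(2) lessThan_iff)
    then have "card (h ` {..<w - l}) = w - l" by (simp add: card_image)
    moreover have "h ` {..<w - l} \<subseteq> {c \<in> {..<k}. y \<in> win A F k x c w}"
      using h ok len by (auto simp: win_def b_def[symmetric])
    moreover have "finite {c \<in> {..<k}. y \<in> win A F k x c w}" by simp
    ultimately show ?thesis using card_mono by metis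
  qed
  have "card T * (w - l) = (\<Sum>y\<in>T. w - l)" by simp
  also have "\<dots> \<le> (\<Sum>y\<in>T. card {c \<in> {..<k}. y \<in> win A F k x c w})" by (intro sum_mono each)
  also have "\<dots> \<le> (\<Sum>y\<in>A. card {c \<in> {..<k}. y \<in> win A F k x c w})"
    by (rule sum_mono2) (use fin TA in auto)
  also have "\<dots> = (\<Sum>y\<in>A. \<Sum>c<k. of_bool (y \<in> win A F k x c w))"
    by (simp only: sum_of_bool_card[OF finite_lessThan])
  also have "\<dots> = (\<Sum>c<k. \<Sum>y\<in>A. of_bool (y \<in> win A F k x c w))" by (rule sum.swap)
  also have "\<dots> = (\<Sum>c<k. card {y \<in> A. y \<in> win A F k x c w})"
    by (simp only: sum_of_bool_card[OF fin])
  also have "\<dots> = (\<Sum>c<k. card (win A F k x c w))"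
    by (intro sum.cong refl arg_cong[of _ _ card]) (auto simp: win_def ok_def)
  finally have "real (card T * (w - l)) \<le> real (\<Sum>c<k. card (win A F k x c w))"
    by (rule of_nat_mono)
  also have "\<dots> = (\<Sum>c<k. real (card (win A F k x c w)))" by simp
  also have "\<dots> \<le> (\<Sum>c<k. b)" by (intro sum_mono b) auto
  finally show ?thesis by (simp add: T_def)
qed

text \<open>The three terms account for the diagonal, the uncolored pairs, and, by Markov's
  inequality applied to \<open>sum_card_bad_le\<close>, the pairs in too many bad triples.\<close>

lemma sum_not_ok_le:
  assumes col: "colored A F k D"
  defines "N \<equiv> real (card A)"
  shows "(\<Sum>x\<in>A. \<Sum>y\<in>A. of_bool (\<not> ok A F k x y)) \<le> N + N * real D + 6 / 10000 * N ^ 2"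
proof -
  note fin = coloredD(1)[OF col]
  define Q where "Q = (\<Sum>x\<in>A. \<Sum>y\<in>A. real (card {z \<in> A. bad x y z}))"
  have "Q = real (\<Sum>x\<in>A. \<Sum>y\<in>A. card {z \<in> A. bad x y z})" by (simp add: Q_def)
  also have "\<dots> \<le> real (6 * s * card A ^ 2)" by (intro of_nat_mono sum_card_bad_le fin)
  finally have Q_le: "Q \<le> 6 * real s * N ^ 2" by (simp add: N_def)
  define heavy where "heavy x y \<longleftrightarrow> 10000 * s < card {z \<in> A. bad x y z}" for x y
  define V where "V x y \<longleftrightarrow> y \<noteq> x \<and> \<not> (F x y < k \<and> F y x < k)" for x y
  define R where "R = (\<Sum>x\<in>A. \<Sum>y\<in>A. of_bool (heavy x y) :: real)"
  \<comment> \<open>A heavy pair has at least \<open>10000 * s + 1\<close> bad thirds; the extra 1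
    keeps the factor positive when \<open>s = 0\<close>.\<close>
  have "(10000 * real s + 1) * R = (\<Sum>x\<in>A. \<Sum>y\<in>A. (10000 * real s + 1) * of_bool (heavy x y))"
    unfolding R_def by (simp only: sum_distrib_left)
  also have "\<dots> \<le> Q"
    unfolding Q_def by (intro sum_mono) (auto simp: heavy_def of_bool_def)
  finally have "(10000 * real s + 1) * R \<le> 6 * real s * N ^ 2" using Q_le by simp
  also have "\<dots> \<le> (10000 * real s + 1) * (6 / 10000 * N ^ 2)" by (simp add: algebra_simps)
  finally have R: "R \<le> 6 / 10000 * N ^ 2"
    by (rule mult_left_le_imp_le) simp
  have "(\<Sum>x\<in>A. \<Sum>y\<in>A. of_bool (\<not> ok A F k x y))
      \<le> (\<Sum>x\<in>A. \<Sum>y\<in>A. of_bool (y = x) + of_bool (V x y) + of_bool (heavy x y) :: real)"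
    by (intro sum_mono) (auto simp: ok_def V_def heavy_def of_bool_def)
  also have "\<dots> = (\<Sum>x\<in>A. \<Sum>y\<in>A. of_bool (y = x)) + (\<Sum>x\<in>A. \<Sum>y\<in>A. of_bool (V x y)) + R"
    unfolding R_def by (simp only: sum.distrib)
  also have "(\<Sum>x\<in>A. \<Sum>y\<in>A. of_bool (y = x)) = N"
    using fin by (simp add: N_def of_bool_def)
  also have "(\<Sum>x\<in>A. \<Sum>y\<in>A. of_bool (V x y)) \<le> (\<Sum>x\<in>A. real D)"
  proof (rule sum_mono)
    fix x assume "x \<in> A"
    then show "(\<Sum>y\<in>A. of_bool (V x y)) \<le> real D"
      using coloredD(2)[OF col, of x] fin by (simp add: Int_def V_def)
  qed
  finally show ?thesis using R by (simp add: N_def)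
qed

section \<open>Counting centered triples\<close>

text \<open>Induction step for the bound \<open>M * k powr (39 / 10)\<close>, using only color
  counts up to \<open>4 * k / 5\<close>. If it failed, nearly all triples would be clean and hence
  have a center, but the arc estimates allow fewer centers than that.\<close>

lemma card_le_step:
  fixes M :: real
  assumes col: "colored A F k D" and k: "1000 \<le> k"
    and M: "1000 * (real D + real s + 1) \<le> M"
    and IH: "\<And>S F' w. \<lbrakk>1 \<le> w; 5 * w \<le> 4 * k; colored S F' w (D + 10000 * s)\<rbrakk>
      \<Longrightarrow> real (card S) \<le> M * real w powr (39 / 10)"
  shows "real (card A) \<le> M * real k powr (39 / 10)"
proof (rule ccontr)
  define N where "N = real (card A)"
  define B where "B w = M * real w powr (39 / 10)" for w :: nat
  define U where "U = B k"
  \<comment> \<open>Chosen so that \<open>1 + 2 * g * (67 / 1000)\<close> \<le> \<open>g\<close>,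
    where 67/1000 bounds (1/2) to the power 39/10.\<close>
  define g :: real where "g = 231 / 200"
  assume "\<not> real (card A) \<le> M * real k powr (39 / 10)"
  then have UN: "U < N" by (simp add: U_def B_def N_def)
  note fin = coloredD(1)[OF col]
  have M0: "0 < M" using M by (smt (verit) of_nat_0_le_iff)
  have B_nonneg: "0 \<le> B w" for w using M0 by (simp add: B_def)
  have U0: "0 \<le> U" using B_nonneg by (simp add: U_def)
  have scale: "B w \<le> B v * b" if "real w \<le> r * real v" "0 < r" "0 < b" "r ^ 39 \<le> b ^ 10" for w v r b
  proof -
    have "real w powr (39 / 10) \<le> (r * real v) powr (39 / 10)"
      using that by (intro powr_mono2) auto
    also have "\<dots> = r powr (39 / 10) * real v powr (39 / 10)"
      using that by (simp add: powr_mult)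
    also have "\<dots> \<le> b * real v powr (39 / 10)"
      using powr_39_10_le[of r b] that by (intro mult_right_mono) auto
    finally show ?thesis using M0 by (simp add: B_def mult.assoc mult_left_mono mult.commute)
  qed
  have half: "B i \<le> B w * (67 / 1000)" if "i \<le> w div 2" for i w
    by (rule scale[where r = "1 / 2"]) (use that in \<open>auto simp: power_divide\<close>)
  have win_le: "real (card (win A F k x c w)) \<le> g * B w" if "x \<in> A" "c < k" "5 * w \<le> 4 * k" for x c w
  proof (rule card_win_le[OF col \<open>x \<in> A\<close>, where W = "4 * k div 5"])
    show "real (card S) \<le> B w" if "1 \<le> w" "w \<le> 4 * k div 5" "colored S F' w (D + 10000 * s)" for S F' w
      unfolding B_def by (rule IH) (use that in auto)
    show "B w + g * B i + g * B j \<le> g * B w" if "1 \<le> w" "i \<le> w div 2" "j \<le> w div 2" for w i j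
      using half[OF that(2)] half[OF that(3)] B_nonneg[of w] by (simp add: g_def)
  qed (use that in \<open>auto simp: B_def\<close>)

  define len where "len x y = rot k (F x y) (F y x)" for x y
  have len_less: "len x y < k" if "ok A F k x y" for x y
    using that by (auto simp: len_def ok_def intro: rot_less)
  have len_swap: "len y x = (if len x y = 0 then 0 else k - len x y)" if "ok A F k x y" for x y
    unfolding len_def by (rule rot_swap) (use that in \<open>auto simp: ok_def\<close>)
  \<comment> \<open>The complement of an arc that is not short has at most \<open>4 * k / 5\<close>
    colors, so the induction hypothesis reaches it.\<close>
  define short where "short x y \<longleftrightarrow> ok A F k x y \<and> 5 * len x y < k" for x y
  define S where "S = (\<Sum>x\<in>A. \<Sum>y\<in>A. of_bool (short x y) :: real)"
  have card_short: "real (card {y \<in> A. short x y}) \<le> 10664 / 100000 * N" if x: "x \<in> A" for x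
  proof -
    \<comment> \<open>Windows of 3/10 of the circle contain each short arc about
      \<open>k / 10\<close> times. The rounding loss is absorbed in 99/1000 because \<open>k\<close>
      is at least 1000.\<close>
    define w l where "w = 3 * k div 10" and "l = (k - 1) div 5"
    have "{y \<in> A. short x y} = {y. ok A F k x y \<and> rot k (F x y) (F y x) \<le> l}"
      using k by (auto simp: short_def len_def l_def ok_def)
    then have "real (card {y \<in> A. short x y}) * real (w - l) \<le> real k * (g * B w)"
      using card_short_arcs_le[of A w k l F x "g * B w"] fin win_le[OF x] k by (auto simp: w_def l_def)
    moreover have "99 / 1000 * real k \<le> real (w - l)" using k unfolding w_def l_def by linarith
    ultimately have "real (card {y \<in> A. short x y}) * (99 / 1000 * real k) \<le> real k * (g * B w)"
      by (meson mult_left_mono of_nat_0_le_iff order_trans)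
    moreover have "B w \<le> U * (914 / 100000)"
      unfolding U_def by (rule scale[where r = "3 / 10"]) (auto simp: w_def power_divide)
    ultimately have "real (card {y \<in> A. short x y}) * (99 / 1000) * real k \<le> (g * (U * (914 / 100000))) * real k"
      by (smt (verit, best) B_nonneg g_def mult.assoc mult.commute mult_left_mono of_nat_0_le_iff divide_nonneg_nonneg)
    then have "real (card {y \<in> A. short x y}) * (99 / 1000) \<le> g * (U * (914 / 100000))"
      using k by simp
    then show ?thesis using UN U0 by (simp add: g_def)
  qed
  have S_le: "S \<le> 10664 / 100000 * N ^ 2"
  proof -
    have "S = (\<Sum>x\<in>A. real (card {y \<in> A. short x y}))"
      unfolding S_def using fin by (simp add: Int_def)
    also have "\<dots> \<le> (\<Sum>x\<in>A. 10664 / 100000 * N)" by (intro sum_mono card_short)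
    finally show ?thesis by (simp add: N_def power2_eq_square)
  qed
  have S0: "0 \<le> S" by (simp add: S_def sum_nonneg)

  \<comment> \<open>Up to the factor \<open>g\<close>, this bounds the number of arcs at
    \<open>x\<close> disjoint from that of \<open>(x, y)\<close>, when the latter is not
    short.\<close>
  define h where "h x y = (if ok A F k x y \<and> \<not> 5 * len x y < k then B (k - len x y) else 0)" for x y
  \<comment> \<open>The arcs of \<open>(x, y)\<close> and \<open>(y, x)\<close> have complementary
    lengths \<open>L\<close> and \<open>k - L\<close>. If the first is short, only
    \<open>B L\<close> can remain, at most 19/10000 of \<open>U\<close>, and 4281 - 4262 =
    19.\<close>
  have h_pair: "h x y + h y x \<le> U * (4281 / 10000 - 4262 / 10000 * of_bool (short x y))" for x y
  proof (cases "ok A F k x y")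
    case False
    then show ?thesis using ok_sym U0 by (simp add: h_def short_def)
  next
    case ok: True
    then have ok': "ok A F k y x" by (simp add: ok_sym)
    define L where "L = len x y"
    have L: "L < k" "len y x = (if L = 0 then 0 else k - L)"
      using len_less len_swap ok by (auto simp: L_def)
    have fifth: "B i \<le> U * (19 / 10000)" if "5 * i \<le> k" for i
      unfolding U_def by (rule scale[where r = "1 / 5"]) (use that in \<open>auto simp: power_divide\<close>)
    show ?thesis
    proof (cases "5 * L < k")
      case True
      then have "h x y = 0" "h y x \<le> U * (19 / 10000)"
        using L ok ok' fifth[of L] U0 by (auto simp: h_def L_def)
      then show ?thesis using True ok by (simp add: short_def L_def)
    next
      case False
      have sh: "\<not> short x y" using False by (simp add: short_def L_def)
      have hx: "h x y = B (k - L)" using False ok by (simp add: h_def L_def)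
      show ?thesis
      proof (cases "5 * (k - L) < k")
        case True
        then have "h y x = 0" using L False by (auto simp: h_def)
        then show ?thesis using hx fifth[of "k - L"] True sh U0 by simp
      next
        case nshort: False
        have hy: "h y x = B L" using L False nshort ok' k by (auto simp: h_def)
        have three: "B i \<le> U * (914 / 100000)" if "10 * i \<le> 3 * k" for i
          unfolding U_def by (rule scale[where r = "3 / 10"]) (use that in \<open>auto simp: power_divide\<close>)
        have five: "B i \<le> U * (67 / 1000)" if "2 * i \<le> k" for i
          unfolding U_def by (rule scale[where r = "1 / 2"]) (use that in \<open>auto simp: power_divide\<close>)
        have seven: "B i \<le> U * (249 / 1000)" if "10 * i \<le> 7 * k" for i
          unfolding U_def by (rule scale[where r = "7 / 10"]) (use that in \<open>auto simp: power_divide\<close>)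
        have eight: "B i \<le> U * (4189 / 10000)" if "5 * i \<le> 4 * k" for i
          unfolding U_def by (rule scale[where r = "4 / 5"]) (use that in \<open>auto simp: power_divide\<close>)
        \<comment> \<open>With both lengths between \<open>k / 5\<close> and
          \<open>4 * k / 5\<close>, a subdivision at 3/10, 1/2 and 7/10 suffices; the worst pieces
          are the outer ones, giving 914/100000 + 4189/10000.\<close>
        consider "10 * L \<le> 3 * k" | "10 * (k - L) \<le> 3 * k"
          | "2 * L \<le> k" "10 * (k - L) \<le> 7 * k" | "2 * (k - L) \<le> k" "10 * L \<le> 7 * k"
          using L(1) by linarith
        then have "B (k - L) + B L \<le> U * (4281 / 10000)"
        proof cases
          case 1
          moreover have "5 * (k - L) \<le> 4 * k" using False by linarith
          ultimately have "B L \<le> U * (914 / 100000)" "B (k - L) \<le> U * (4189 / 10000)"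
            using three eight by blast+
          then show ?thesis using U0 by simp
        next
          case 2
          moreover have "5 * L \<le> 4 * k" using nshort L(1) by linarith
          ultimately have "B (k - L) \<le> U * (914 / 100000)" "B L \<le> U * (4189 / 10000)"
            using three eight by blast+
          then show ?thesis using U0 by simp
        next
          case 3
          then show ?thesis using five[of L] seven[of "k - L"] U0 by simp
        next
          case 4
          then show ?thesis using five[of "k - L"] seven[of L] U0 by simp
        qed
        then show ?thesis using hx hy sh by simp
      qed
    qed
  qed
  define H where "H = (\<Sum>x\<in>A. \<Sum>y\<in>A. h x y)"
  have H_le: "2 * H \<le> U * (4281 / 10000 * N ^ 2 - 4262 / 10000 * S)"
  proof -
    have "H = (\<Sum>x\<in>A. \<Sum>y\<in>A. h y x)" unfolding H_def by (rule sum.swap)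
    then have "2 * H = (\<Sum>x\<in>A. \<Sum>y\<in>A. h x y + h y x)" by (simp add: H_def sum.distrib)
    also have "\<dots> \<le> (\<Sum>x\<in>A. \<Sum>y\<in>A. U * (4281 / 10000 - 4262 / 10000 * of_bool (short x y)))"
      by (intro sum_mono h_pair)
    also have "\<dots> = U * (\<Sum>x\<in>A. \<Sum>y\<in>A. 4281 / 10000 - 4262 / 10000 * of_bool (short x y))"
      by (simp only: sum_distrib_left)
    also have "(\<Sum>x\<in>A. \<Sum>y\<in>A. 4281 / 10000 - 4262 / 10000 * of_bool (short x y))
        = (\<Sum>x\<in>A. \<Sum>y\<in>A. 4281 / 10000) - 4262 / 10000 * S"
      unfolding S_def by (simp only: sum_subtractf sum_distrib_left)
    also have "(\<Sum>x\<in>A. \<Sum>y\<in>A. 4281 / 10000) = 4281 / 10000 * N ^ 2"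
      by (simp add: N_def power2_eq_square)
    finally show ?thesis .
  qed

  define ctr where "ctr x y z \<longleftrightarrow> ok A F k x y \<and> ok A F k x z \<and>
    disjoint_arcs (F x y) (F y x) (F x z) (F z x)" for x y z
  \<comment> \<open>A short arc is charged trivially with all \<open>N\<close> choices of
    \<open>z\<close>; otherwise the arc of \<open>(x, z)\<close> lies in the window complementary to
    that of \<open>(x, y)\<close>.\<close>
  have ctr_le: "(\<Sum>z\<in>A. of_bool (ctr x y z)) \<le> N * of_bool (short x y) + g * h x y"
    if x: "x \<in> A" and "y \<in> A" for x y
  proof -
    have eq: "(\<Sum>z\<in>A. of_bool (ctr x y z)) = real (card {z \<in> A. ctr x y z})"
      using fin by (simp add: Int_def)
    show ?thesis
    proof (cases "ok A F k x y")
      case False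
      then show ?thesis by (simp add: ctr_def short_def h_def)
    next
      case ok: True
      have gh: "0 \<le> g * h x y" using B_nonneg by (simp add: g_def h_def)
      show ?thesis
      proof (cases "short x y")
        case True
        have "card {z \<in> A. ctr x y z} \<le> card A" using fin by (intro card_mono) auto
        then show ?thesis using eq True gh by (simp add: N_def)
      next
        case False
        then have n: "\<not> 5 * len x y < k" using ok by (simp add: short_def)
        define e where "e = (if F y x + 1 = k then 0 else F y x + 1)"
        have Fk: "F y x < k" using ok by (simp add: ok_def)
        have "{z \<in> A. ctr x y z} \<subseteq> win A F k x e (k - 1 - len x y)"
        proof
          fix z assume "z \<in> {z \<in> A. ctr x y z}"
          then have c: "ok A F k x z" "disjoint_arcs (F x y) (F y x) (F x z) (F z x)"
            by (auto simp: ctr_def)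
          have "rot k e (F x z) \<le> rot k e (F z x) \<and> rot k e (F z x) < k - 1 - rot k (F x y) (F y x)"
            unfolding e_def by (rule disjoint_arcs_rot) (use c ok in \<open>auto simp: ok_def\<close>)
          then show "z \<in> win A F k x e (k - 1 - len x y)" using c by (simp add: win_def len_def)
        qed
        then have "card {z \<in> A. ctr x y z} \<le> card (win A F k x e (k - 1 - len x y))"
          using fin finite_win by (intro card_mono) auto
        also have "real \<dots> \<le> g * B (k - 1 - len x y)"
          by (rule win_le[OF x]) (use Fk n in \<open>auto simp: e_def\<close>)
        also have "\<dots> \<le> g * B (k - len x y)"
          using M0 by (auto simp: g_def B_def intro!: mult_left_mono powr_mono2)
        finally show ?thesis using eq ok n False by (simp add: h_def)
      qed
    qed
  qed
  define C where "C = (\<Sum>x\<in>A. \<Sum>y\<in>A. \<Sum>z\<in>A. of_bool (ctr x y z) :: real)"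
  have C_le: "C \<le> N * S + g * H"
  proof -
    have "C \<le> (\<Sum>x\<in>A. \<Sum>y\<in>A. N * of_bool (short x y) + g * h x y)"
      unfolding C_def by (intro sum_mono ctr_le)
    also have "\<dots> = N * S + g * H"
      unfolding S_def H_def by (simp only: sum.distrib sum_distrib_left)
    finally show ?thesis .
  qed

  define P where "P = (\<Sum>x\<in>A. \<Sum>y\<in>A. of_bool (\<not> ok A F k x y) :: real)"
  define Q where "Q = (\<Sum>x\<in>A. \<Sum>y\<in>A. real (card {z \<in> A. bad x y z}))"
  have Q_le: "Q \<le> 6 * real s * N ^ 2"
  proof -
    have "Q = real (\<Sum>x\<in>A. \<Sum>y\<in>A. card {z \<in> A. bad x y z})" by (simp add: Q_def)
    also have "\<dots> \<le> real (6 * s * card A ^ 2)" by (intro of_nat_mono sum_card_bad_le fin)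
    finally show ?thesis by (simp add: N_def)
  qed
  have P_le: "P \<le> N + N * real D + 6 / 10000 * N ^ 2"
    unfolding P_def N_def by (rule sum_not_ok_le[OF col])
  define clean where "clean x y z \<longleftrightarrow> ok A F k x y \<and> ok A F k y z \<and> ok A F k x z \<and> \<not> bad x y z" for x y z
  define T where "T = (\<Sum>x\<in>A. \<Sum>y\<in>A. \<Sum>z\<in>A. of_bool (clean x y z) :: real)"
  have T_ge: "N ^ 3 \<le> T + 3 * (N * P) + Q"
  proof -
    have "N ^ 3 = (\<Sum>x\<in>A. \<Sum>y\<in>A. \<Sum>z\<in>A. 1)" by (simp add: N_def power3_eq_cube)
    also have "\<dots> \<le> (\<Sum>x\<in>A. \<Sum>y\<in>A. \<Sum>z\<in>A. of_bool (clean x y z) + of_bool (\<not> ok A F k x y)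
        + of_bool (\<not> ok A F k y z) + of_bool (\<not> ok A F k x z) + of_bool (bad x y z))"
      by (intro sum_mono) (auto simp: clean_def of_bool_def)
    also have "\<dots> = T + (\<Sum>x\<in>A. \<Sum>y\<in>A. \<Sum>z\<in>A. of_bool (\<not> ok A F k x y))
        + (\<Sum>x\<in>A. \<Sum>y\<in>A. \<Sum>z\<in>A. of_bool (\<not> ok A F k y z))
        + (\<Sum>x\<in>A. \<Sum>y\<in>A. \<Sum>z\<in>A. of_bool (\<not> ok A F k x z))
        + (\<Sum>x\<in>A. \<Sum>y\<in>A. \<Sum>z\<in>A. of_bool (bad x y z))"
      unfolding T_def by (simp only: sum.distrib)
    also have "(\<Sum>x\<in>A. \<Sum>y\<in>A. \<Sum>z\<in>A. of_bool (\<not> ok A F k x y)) = N * P"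
      by (simp add: P_def N_def sum_distrib_left del: sum_of_bool_eq)
    also have "(\<Sum>x\<in>A. \<Sum>y\<in>A. \<Sum>z\<in>A. of_bool (\<not> ok A F k y z)) = N * P"
      by (simp add: P_def N_def del: sum_of_bool_eq)
    also have "(\<Sum>x\<in>A. \<Sum>y\<in>A. \<Sum>z\<in>A. of_bool (\<not> ok A F k x z)) = N * P"
      by (simp add: P_def N_def sum_distrib_left del: sum_of_bool_eq)
    also have "(\<Sum>x\<in>A. \<Sum>y\<in>A. \<Sum>z\<in>A. of_bool (bad x y z)) = Q"
      using fin by (simp add: Q_def Int_def)
    finally show ?thesis by simp
  qed
  \<comment> \<open>The two cyclic orders of a clean triple give a center; each rotation of the
    triple accounts for one copy of \<open>C\<close>.\<close>
  have T_le: "T \<le> 3 * C"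
  proof -
    have "of_bool (clean x y z) \<le> (of_bool (ctr x y z) + of_bool (ctr y z x) + of_bool (ctr z x y) :: real)" for x y z
    proof (cases "clean x y z")
      case True
      then have o: "ok A F k x y" "ok A F k y z" "ok A F k x z" "ok A F k y x" "ok A F k z y" "ok A F k z x" "\<not> bad x y z"
        using ok_sym by (auto simp: clean_def)
      have 1: "cw (F x y) (F y z) (F z x)"
        by (rule coloredD(3)[OF col]) (use o in \<open>auto simp: ok_def\<close>)
      have 2: "cw (F x z) (F z y) (F y x)"
        by (rule coloredD(3)[OF col]) (use o in \<open>auto simp: ok_def bad_swap\<close>)
      show ?thesis using center_exists[OF 1 2] o by (auto simp: ctr_def)
    qed simp
    then have "T \<le> (\<Sum>x\<in>A. \<Sum>y\<in>A. \<Sum>z\<in>A. of_bool (ctr x y z) + of_bool (ctr y z x) + of_bool (ctr z x y))"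
      unfolding T_def by (intro sum_mono)
    also have "\<dots> = C + (\<Sum>x\<in>A. \<Sum>y\<in>A. \<Sum>z\<in>A. of_bool (ctr y z x)) + (\<Sum>x\<in>A. \<Sum>y\<in>A. \<Sum>z\<in>A. of_bool (ctr z x y))"
      unfolding C_def by (simp only: sum.distrib)
    also have "(\<Sum>x\<in>A. \<Sum>y\<in>A. \<Sum>z\<in>A. of_bool (ctr y z x)) = C"
    proof -
      have "(\<Sum>x\<in>A. \<Sum>y\<in>A. \<Sum>z\<in>A. of_bool (ctr y z x)) = (\<Sum>y\<in>A. \<Sum>x\<in>A. \<Sum>z\<in>A. of_bool (ctr y z x) :: real)"
        by (rule sum.swap)
      also have "\<dots> = (\<Sum>y\<in>A. \<Sum>z\<in>A. \<Sum>x\<in>A. of_bool (ctr y z x))"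
        by (rule sum.cong[OF refl], rule sum.swap)
      finally show ?thesis by (simp only: C_def)
    qed
    also have "(\<Sum>x\<in>A. \<Sum>y\<in>A. \<Sum>z\<in>A. of_bool (ctr z x y)) = C"
    proof -
      have "(\<Sum>x\<in>A. \<Sum>y\<in>A. \<Sum>z\<in>A. of_bool (ctr z x y)) = (\<Sum>x\<in>A. \<Sum>z\<in>A. \<Sum>y\<in>A. of_bool (ctr z x y) :: real)"
        by (rule sum.cong[OF refl], rule sum.swap)
      also have "\<dots> = (\<Sum>z\<in>A. \<Sum>x\<in>A. \<Sum>y\<in>A. of_bool (ctr z x y))"
        by (rule sum.swap)
      finally show ?thesis by (simp only: C_def)
    qed
    finally show ?thesis by simp
  qed

  have "1 \<le> real k powr (39 / 10)" using k by (simp add: ge_one_powr_ge_zero)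
  then have "M \<le> U" using M0 by (simp add: U_def B_def)
  then have MN: "1000 * (real D + real s + 1) \<le> N" using M UN by linarith
  have N0: "0 < N" using MN by (smt (verit) of_nat_0_le_iff)
  have "N ^ 3 \<le> 3 * (N * S) + 3 * g * H + 3 * (N * P) + Q"
    using T_ge T_le C_le by (simp add: algebra_simps)
  also have "\<dots> \<le> 3 * (N * S) + 3 / 2 * g * (N * (4281 / 10000 * N ^ 2 - 4262 / 10000 * S))
      + 3 * (N * (N + N * real D + 6 / 10000 * N ^ 2)) + 6 * real s * N ^ 2"
  proof -
    \<comment> \<open>Nonnegativity of the bracket permits replacing \<open>U\<close> by the larger
      \<open>N\<close>, which makes all main terms multiples of \<open>N ^ 3\<close>.\<close>
    have "0 \<le> 4281 / 10000 * N ^ 2 - 4262 / 10000 * S"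
      using S_le zero_le_power2[of N] by linarith
    then have "2 * H \<le> N * (4281 / 10000 * N ^ 2 - 4262 / 10000 * S)"
      using H_le UN by (smt (verit) mult_right_mono)
    then have "3 * g * H \<le> 3 / 2 * g * (N * (4281 / 10000 * N ^ 2 - 4262 / 10000 * S))"
      by (simp add: g_def)
    moreover have "N * P \<le> N * (N + N * real D + 6 / 10000 * N ^ 2)"
      using P_le N0 by (intro mult_left_mono) auto
    ultimately show ?thesis using Q_le by linarith
  qed
  also have "\<dots> = N * S * (3 - 3 / 2 * g * (4262 / 10000)) + 3 / 2 * g * (4281 / 10000) * N ^ 3
      + 18 / 10000 * N ^ 3 + N ^ 2 * (3 + 3 * real D + 6 * real s)"
    by (simp add: algebra_simps power2_eq_square power3_eq_cube)
  also have "\<dots> \<le> (10664 / 100000 * (3 - 3 / 2 * g * (4262 / 10000)) + 3 / 2 * g * (4281 / 10000)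
      + 18 / 10000 + 6 / 1000) * N ^ 3"
  proof -
    have "N * S \<le> N * (10664 / 100000 * N ^ 2)" using S_le N0 by (intro mult_left_mono) auto
    then have "N * S \<le> 10664 / 100000 * N ^ 3" by (simp add: power2_eq_square power3_eq_cube)
    moreover have "N ^ 2 * (3 + 3 * real D + 6 * real s) \<le> N ^ 2 * (6 / 1000 * N)"
      using MN by (intro mult_left_mono) auto
    then have "N ^ 2 * (3 + 3 * real D + 6 * real s) \<le> 6 / 1000 * N ^ 3"
      by (simp add: power2_eq_square power3_eq_cube)
    ultimately show ?thesis by (simp add: g_def algebra_simps)
  qed
  \<comment> \<open>The coefficient is about 0.991.\<close>
  also have "\<dots> < 1 * N ^ 3" using N0 by (intro mult_strict_right_mono) (auto simp: g_def)
  finally show False by simp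
qed

section \<open>Few colors, and iteration of the step\<close>

text \<open>Start of the induction, where a crude bound suffices. Fix a vertex \<open>x\<close> with
  few partners that are not \<open>ok\<close> and group the others by the color pair
  \<open>(F x y, F y x)\<close>. Inside a group the common color \<open>F x y\<close> cannot occur
  on a good pair, so one color is lost at the price of at most 1000000 groups.\<close>

lemma card_le_exponential:
  assumes "colored A F k D" "k \<le> 1000"
  shows "real (card A) \<le> 4000000 ^ k * (real D + 10000 * real k * real s + real s + 1)"
  using assms
proof (induction k arbitrary: A F D)
  case 0
  note fin = coloredD(1)[OF 0(1)]
  show ?case
  proof (cases "A = {}")
    case False
    then obtain x where x: "x \<in> A" by blast
    have "{y \<in> A. y \<noteq> x \<and> \<not> (F x y < 0 \<and> F y x < 0)} = A - {x}" by auto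
    then have "card (A - {x}) \<le> D" using coloredD(2)[OF 0(1) x] by simp
    then show ?thesis using x fin by simp
  qed simp
next
  case (Suc k)
  let ?k = "Suc k"
  note col = Suc.prems(1) and fin = coloredD(1)[OF Suc.prems(1)]
  define N where "N = real (card A)"
  define b where "b = 4000000 ^ k * (real D + 10000 * real ?k * real s + real s + 1)"
  have b1: "real D + 1 \<le> b"
  proof -
    have "1 * (real D + 1) \<le> 4000000 ^ k * (real D + 10000 * real ?k * real s + real s + 1)"
      by (intro mult_mono) auto
    then show ?thesis by (simp add: b_def)
  qed
  show ?case
  proof (cases "A = {}")
    case True
    then show ?thesis by simp
  next
    case ne: False
    then have N0: "0 < N" using fin by (simp add: N_def card_gt_0_iff)
    have "\<exists>x\<in>A. (\<Sum>y\<in>A. of_bool (\<not> ok A F ?k x y)) \<le> 1 + real D + 6 / 10000 * N"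
    proof (rule ccontr)
      assume "\<not> ?thesis"
      then have "(\<Sum>x\<in>A. 1 + real D + 6 / 10000 * N) < (\<Sum>x\<in>A. \<Sum>y\<in>A. of_bool (\<not> ok A F ?k x y))"
        using fin ne by (intro sum_strict_mono) (auto simp: not_le)
      then show False
        using sum_not_ok_le[OF col] by (simp add: N_def algebra_simps power2_eq_square)
    qed
    then obtain x where x: "x \<in> A" and few: "(\<Sum>y\<in>A. of_bool (\<not> ok A F ?k x y)) \<le> 1 + real D + 6 / 10000 * N"
      by blast
    define Y where "Y = {y \<in> A. ok A F ?k x y}"
    define S where "S c = {y \<in> Y. F x y = fst c \<and> F y x = snd c}" for c
    have "N \<le> real (card Y) + (\<Sum>y\<in>A. of_bool (\<not> ok A F ?k x y))"
    proof -
      have "Y \<union> {y \<in> A. \<not> ok A F ?k x y} = A" by (auto simp: Y_def)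
      then have "card A \<le> card Y + card {y \<in> A. \<not> ok A F ?k x y}"
        using card_Un_le[of Y "{y \<in> A. \<not> ok A F ?k x y}"] by simp
      then show ?thesis using fin by (simp add: N_def Int_def)
    qed
    moreover have "real (card Y) \<le> real (?k ^ 2) * b"
    proof -
      have class_le: "real (card (S c)) \<le> b" if c: "c \<in> {..<?k} \<times> {..<?k}" for c
      proof -
        \<comment> \<open>With the origin just after the forbidden color, that color gets the last
          coordinate \<open>k\<close> and the others are below it.\<close>
        define e where "e = (if fst c + 1 = ?k then 0 else fst c + 1)"
        have "colored (S c) (\<lambda>u v. if F u v < ?k then rot ?k e (F u v) else F u v) k (D + 10000 * s)"
        proof (rule colored_restrict[OF col x])
          show "ok A F ?k x u" if "u \<in> S c" for u using that by (simp add: S_def Y_def)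
          show "e < ?k" "k \<le> ?k" using c by (auto simp: e_def)
          fix u v r
          assume "u \<in> S c" "v \<in> S c" "r < ?k" "cw (F x u) r (F v x)"
          then have "r \<noteq> fst c" "r < ?k" by (auto simp: S_def cw_def)
          then show "rot ?k e r < k" using c by (auto simp: rot_def e_def split: if_splits)
        qed
        then have "real (card (S c)) \<le> 4000000 ^ k * (real (D + 10000 * s) + 10000 * real k * real s + real s + 1)"
          by (rule Suc.IH) (use Suc.prems in simp)
        also have "\<dots> = b" by (simp add: b_def algebra_simps)
        finally show ?thesis .
      qed
      define I where "I = {..<?k} \<times> {..<?k}"
      have I: "finite I" "card I = ?k ^ 2"
        unfolding I_def by (simp_all only: card_cartesian_product card_lessThan power2_eq_square
            finite_cartesian_product finite_lessThan)
      have "Y \<subseteq> (\<Union>c\<in>I. S c)"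
      proof
        fix y assume "y \<in> Y"
        then have "(F x y, F y x) \<in> I" "y \<in> S (F x y, F y x)"
          by (simp_all only: S_def Y_def ok_def I_def mem_Sigma_iff lessThan_iff mem_Collect_eq fst_conv snd_conv simp_thms)
        then show "y \<in> (\<Union>c\<in>I. S c)" by blast
      qed
      moreover have "finite (S c)" for c using fin by (simp add: S_def Y_def)
      ultimately have "card Y \<le> card (\<Union>c\<in>I. S c)" using I by (intro card_mono) auto
      also have "\<dots> \<le> (\<Sum>c\<in>I. card (S c))" by (rule card_UN_le[OF I(1)])
      finally have "real (card Y) \<le> (\<Sum>c\<in>I. real (card (S c)))"
        by (simp only: of_nat_sum[symmetric] of_nat_le_iff)
      also have "\<dots> \<le> (\<Sum>c\<in>I. b)" by (intro sum_mono class_le) (simp only: I_def)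
      also have "\<dots> = real (?k ^ 2) * b" by (simp only: sum_constant I)
      finally show ?thesis .
    qed
    moreover have "real (?k ^ 2) * b \<le> 1000000 * b"
    proof (rule mult_right_mono)
      have "real ?k ^ 2 \<le> 1000 ^ 2" using Suc.prems(2) by (intro power_mono) linarith+
      then show "real (?k ^ 2) \<le> 1000000" by (simp only: of_nat_power) simp
      show "0 \<le> b" using b1 of_nat_0_le_iff[of D, where 'a = real] by linarith
    qed
    ultimately have "N \<le> 4000000 * b" using few b1 of_nat_0_le_iff[of D, where 'a = real] by linarith
    then show ?thesis by (simp add: N_def b_def mult.assoc)
  qed
qed

text \<open>\<open>j\<close> bounds the number of reductions by the factor 4/5. Each reduction adds
  \<open>10000 * s\<close> to the defect, which produces the logarithmic factor; the 1001 pays for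
  the start with at most 1000 colors. \<open>C\<close> stands for \<open>4000000 ^ 1000\<close> and
  is kept abstract.\<close>

lemma card_le_powr:
  assumes "colored A F k D" "1 \<le> k" "real k < (5 / 4) ^ j"
    and C: "\<And>i. i \<le> 1000 \<Longrightarrow> 4000000 ^ i \<le> C"
  shows "real (card A) \<le> C * (real D + 10000 * real (j + 1001) * real s + 1) * real k powr (39 / 10)"
  using assms(1-3)
proof (induction j arbitrary: A F k D)
  case 0
  then show ?case by simp
next
  case (Suc j)
  define M where "M = C * (real D + 10000 * real (Suc j + 1001) * real s + 1)"
  have C1: "4000000 \<le> C" using C[of 1] by simp
  have k1: "1 \<le> real k powr (39 / 10)" using Suc.prems by (simp add: ge_one_powr_ge_zero)
  have "real (card A) \<le> M * real k powr (39 / 10)"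
  proof (cases "k \<le> 1000")
    case True
    have "real (card A) \<le> 4000000 ^ k * (real D + 10000 * real k * real s + real s + 1)"
      by (rule card_le_exponential[OF Suc.prems(1) True])
    also have "\<dots> \<le> M"
    proof -
      have "10000 * real k * real s + real s \<le> 10000 * real (Suc j + 1001) * real s"
      proof -
        have "(10000 * real k + 1) * real s \<le> (10000 * real (Suc j + 1001)) * real s"
          using True by (intro mult_right_mono) auto
        then show ?thesis by (simp add: algebra_simps)
      qed
      then show ?thesis
        unfolding M_def using C[OF True] C1 by (intro mult_mono) auto
    qed
    also have "\<dots> \<le> M * real k powr (39 / 10)"
      using mult_left_mono[OF k1, of M] C1 by (simp add: M_def)
    finally show ?thesis .
  next
    case False
    show ?thesis
    proof (rule card_le_step[OF Suc.prems(1)])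
      show "1000 \<le> k" using False by simp
      have "real s \<le> 10000 * real (Suc j + 1001) * real s"
        using mult_right_mono[of 1 "10000 * real (Suc j + 1001)" "real s"] by simp
      then show "1000 * (real D + real s + 1) \<le> M"
        unfolding M_def using C1 by (intro mult_mono) auto
      fix S F' w
      assume w: "1 \<le> w" "5 * w \<le> 4 * k" and col: "colored S F' w (D + 10000 * s)"
      have "real w \<le> 4 / 5 * real k" using w by linarith
      then have "real w < (5 / 4) ^ j" using Suc.prems(3) by simp
      from Suc.IH[OF col w(1) this]
      have "real (card S) \<le> C * (real (D + 10000 * s) + 10000 * real (j + 1001) * real s + 1) * real w powr (39 / 10)" .
      \<comment> \<open>The growth of the defect exactly offsets the decrease of \<open>j\<close>,
        so the same \<open>M\<close> serves before and after the step.\<close>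
      also have "C * (real (D + 10000 * s) + 10000 * real (j + 1001) * real s + 1) = M"
        by (simp add: M_def algebra_simps)
      finally show "real (card S) \<le> M * real w powr (39 / 10)" .
    qed
  qed
  then show ?case by (simp only: M_def)
qed

end

subsection \<open>Tight paths in tournaments\<close>

definition tight_list :: "'a digraph3 \<Rightarrow> 'a list \<Rightarrow> bool" where
  "tight_list G vs \<longleftrightarrow> distinct vs \<and> set vs \<subseteq> verts G \<and>
     (\<forall>i. i + 2 < length vs \<longrightarrow> (vs ! i, vs ! (i + 1), vs ! (i + 2)) \<in> edges G)"

lemma contains3_if_tight_list:
  assumes vs: "tight_list G vs" and m: "m \<le> length vs"
  shows "contains3 G (tight_path3 m)"
  unfolding contains3_def
proof (intro exI conjI ballI)
  let ?\<phi> = "\<lambda>i. vs ! (i - 1)"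
  show "inj_on ?\<phi> (verts (tight_path3 m))"
    using vs m by (auto simp: tight_list_def tight_path3_def inj_on_def nth_eq_iff_index_eq)
  show "?\<phi> ` verts (tight_path3 m) \<subseteq> verts G"
  proof
    fix v assume "v \<in> ?\<phi> ` verts (tight_path3 m)"
    then obtain i where "1 \<le> i" "i \<le> m" "v = vs ! (i - 1)" by (auto simp: tight_path3_def)
    then have "v \<in> set vs" using m by (auto intro!: nth_mem)
    then show "v \<in> verts G" using vs by (auto simp: tight_list_def)
  qed
  fix e assume "e \<in> edges (tight_path3 m)"
  then obtain i where i: "1 \<le> i" "i + 2 \<le> m" "e = (i, i + 1, i + 2)" by (auto simp: tight_path3_def)
  obtain j where "i = Suc j" using i(1) by (cases i) auto
  then show "case e of (x, y, z) \<Rightarrow> (?\<phi> x, ?\<phi> y, ?\<phi> z) \<in> edges G"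
    using i vs m unfolding tight_list_def by simp
qed

lemma tight_list_extend:
  assumes "tight_list G (us @ [x, y])" "(x, y, z) \<in> edges G" "z \<in> verts G" "z \<notin> set (us @ [x, y])"
  shows "tight_list G ((us @ [x]) @ [y, z])"
  unfolding tight_list_def
proof (intro conjI allI impI)
  show "distinct ((us @ [x]) @ [y, z])" "set ((us @ [x]) @ [y, z]) \<subseteq> verts G"
    using assms by (auto simp: tight_list_def)
  fix i assume i: "i + 2 < length ((us @ [x]) @ [y, z])"
  have eq: "(us @ [x]) @ [y, z] = (us @ [x, y]) @ [z]" by simp
  show "(((us @ [x]) @ [y, z]) ! i, ((us @ [x]) @ [y, z]) ! (i + 1), ((us @ [x]) @ [y, z]) ! (i + 2)) \<in> edges G"
  proof (cases "i = length us")
    case True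
    then show ?thesis using assms(2) by (simp add: nth_append)
  next
    case False
    then have len: "i + 2 < length (us @ [x, y])" using i by simp
    have "((us @ [x]) @ [y, z]) ! j = (us @ [x, y]) ! j" if "j \<le> i + 2" for j
      unfolding eq by (rule nth_append_left) (use that len in linarith)
    then show ?thesis using assms(1) len by (simp only: tight_list_def le_add1 add_le_cancel_left le_refl one_le_numeral)
  qed
qed

text \<open>The summands are arranged as the two cyclic classes of the triple.\<close>

lemma card_edges_orderings3:
  assumes "distinct [x, y, z]"
  shows "card (E \<inter> orderings3 {x, y, z}) =
    of_bool ((x, y, z) \<in> E) + of_bool ((y, z, x) \<in> E) + of_bool ((z, x, y) \<in> E) +
    of_bool ((x, z, y) \<in> E) + of_bool ((z, y, x) \<in> E) + of_bool ((y, x, z) \<in> E)"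
proof -
  let ?O = "{(x, y, z), (y, z, x), (z, x, y), (x, z, y), (z, y, x), (y, x, z)}"
  have "orderings3 {x, y, z} = ?O"
  proof (intro equalityI subsetI)
    fix t assume "t \<in> orderings3 {x, y, z}"
    then obtain a b c where t: "t = (a, b, c)" "distinct [a, b, c]" "{a, b, c} = {x, y, z}"
      by (auto simp: orderings3_def)
    then have "a \<in> {x, y, z}" "b \<in> {x, y, z}" "c \<in> {x, y, z}" by auto
    then show "t \<in> ?O" using t by auto
  next
    fix t assume "t \<in> ?O"
    then show "t \<in> orderings3 {x, y, z}" using assms by (auto simp: orderings3_def)
  qed
  then have "card (E \<inter> orderings3 {x, y, z}) = (\<Sum>t\<in>?O. of_bool (t \<in> E))"
    by (simp add: Int_commute)
  also have "\<dots> = of_bool ((x, y, z) \<in> E) + of_bool ((y, z, x) \<in> E) + of_bool ((z, x, y) \<in> E) +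
    of_bool ((x, z, y) \<in> E) + of_bool ((z, y, x) \<in> E) + of_bool ((y, x, z) \<in> E)"
    using assms by (simp del: sum_of_bool_eq add: add.assoc)
  finally show ?thesis .
qed

lemma contains3_tight_path3_le:
  assumes "contains3 G (tight_path3 m)" "finite (verts G)"
  shows "m \<le> card (verts G)"
proof -
  obtain \<phi> where "inj_on \<phi> {1..m}" "\<phi> ` {1..m} \<subseteq> verts G"
    using assms(1) by (auto simp: contains3_def tight_path3_def)
  then have "card {1..m} \<le> card (verts G)" using assms(2) by (metis card_inj_on_le)
  then show ?thesis by simp
qed

text \<open>Take the orderings whose middle vertex is not the smallest, four out of six. Existence
  is needed for the set under \<open>Max\<close> to be finite.\<close>

lemma tournament3_4_exists: "\<exists>G :: nat digraph3. tournament3 4 G \<and> card (verts G) = n"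
proof -
  define E where "E = {(x, y, z). x < n \<and> y < n \<and> z < n \<and> distinct [x, y, z] \<and> \<not> (y < x \<and> y < z)}"
  define G where "G = \<lparr>verts = {..<n}, edges = E\<rparr>"
  have "card (E \<inter> orderings3 S) = 4" if S: "S \<subseteq> {..<n}" "card S = 3" for S
  proof -
    have fin: "finite S" using S(1) finite_subset by blast
    define a where "a = Min S"
    have a: "a \<in> S" using S fin by (auto simp: a_def intro!: Min_in)
    then have "card (S - {a}) = 2" using S fin by simp
    then obtain b c where bc: "S - {a} = {b, c}" "b \<noteq> c" by (auto simp: card_2_iff)
    then have Seq: "S = {a, b, c}" using a by blast
    have mem: "b \<in> S" "c \<in> S" "b \<noteq> a" "c \<noteq> a" using bc(1) by blast+
    then have ab: "a < b" "a < c"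
      using Min_le[OF fin mem(1)] Min_le[OF fin mem(2)] by (simp_all add: a_def[symmetric])
    have "b < n" "c < n" "a < n" using S(1) mem a by blast+
    then show ?thesis
      unfolding Seq using ab bc(2) by (subst card_edges_orderings3) (simp_all add: E_def)
  qed
  moreover have "is_digraph3 G" by (auto simp: is_digraph3_def G_def E_def)
  ultimately have "tournament3 4 G" by (simp add: tournament3_def G_def)
  then show ?thesis by (intro exI[of _ G]) (simp add: G_def)
qed

lemma f3_4_ge:
  assumes "\<And>G :: nat digraph3. \<lbrakk>tournament3 4 G; card (verts G) = n\<rbrakk> \<Longrightarrow> contains3 G (tight_path3 m)"
  shows "m \<le> f3 n 4"
proof -
  let ?S = "{s. \<forall>G :: nat digraph3. tournament3 4 G \<and> card (verts G) = n \<longrightarrow> contains3 G (tight_path3 s)}"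
  obtain G :: "nat digraph3" where G: "tournament3 4 G" "card (verts G) = n"
    using tournament3_4_exists by blast
  then have fin: "finite (verts G)" by (simp add: tournament3_def is_digraph3_def)
  have "?S \<subseteq> {..n}"
  proof
    fix s assume "s \<in> ?S"
    then have "contains3 G (tight_path3 s)" using G by simp
    then show "s \<in> {..n}" using contains3_tight_path3_le[OF _ fin] G by simp
  qed
  then have "finite ?S" by (rule finite_subset) simp
  moreover have "m \<in> ?S" using assms by simp
  ultimately show ?thesis unfolding f3_def by (rule Max_ge)
qed

text \<open>The color of \<open>(x, y)\<close> is the number of vertices preceding
  \<open>x, y\<close> on a longest tight path ending there, and the vertices of that initial part
  are the exceptions. Every pair is colored, hence defect 0.\<close>

lemma tournament3_coloring:
  fixes G :: "'a digraph3"
  assumes T: "tournament3 4 G" and no: "\<not> contains3 G (tight_path3 m)"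
  obtains X F where "sparse_exceptions X m" "sparse_exceptions.colored X (verts G) F m 0"
proof -
  let ?V = "verts G"
  have finV: "finite ?V" using T by (simp add: tournament3_def is_digraph3_def)
  have short: "length vs < m" if "tight_list G vs" for vs
    using contains3_if_tight_list[OF that] no by (meson not_le)
  have "\<exists>us. tight_list G (us @ [x, y]) \<and> (\<forall>us'. tight_list G (us' @ [x, y]) \<longrightarrow> length us' \<le> length us)"
    if "x \<in> ?V" "y \<in> ?V" "x \<noteq> y" for x y
  proof -
    have "tight_list G ([] @ [x, y])" using that by (simp add: tight_list_def)
    moreover have "\<forall>us. tight_list G (us @ [x, y]) \<longrightarrow> length us < m"
    proof (intro allI impI)
      fix us assume "tight_list G (us @ [x, y])"
      from short[OF this] show "length us < m" by simp
    qed
    ultimately show ?thesis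
      by (rule ex_has_greatest_nat[where f = length and P = "\<lambda>us. tight_list G (us @ [x, y])"])
  qed
  note ex = this
  define P where "P x y = (SOME us. tight_list G (us @ [x, y]) \<and>
    (\<forall>us'. tight_list G (us' @ [x, y]) \<longrightarrow> length us' \<le> length us))" for x y
  have P_spec: "tight_list G (P x y @ [x, y]) \<and>
      (\<forall>us. tight_list G (us @ [x, y]) \<longrightarrow> length us \<le> length (P x y))"
    if "x \<in> ?V" "y \<in> ?V" "x \<noteq> y" for x y
    unfolding P_def by (rule someI_ex[OF ex[OF that]])
  have P: "tight_list G (P x y @ [x, y])" if "x \<in> ?V" "y \<in> ?V" "x \<noteq> y" for x y
    using P_spec[OF that] by (rule conjunct1)
  have P_max: "length us \<le> length (P x y)"
    if "x \<in> ?V" "y \<in> ?V" "x \<noteq> y" "tight_list G (us @ [x, y])" for x y us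
    using P_spec[OF that(1-3)] that(4) by (elim conjE allE impE)
  define F where "F x y = length (P x y)" for x y
  define X where "X x y z \<longleftrightarrow> x \<in> ?V \<and> y \<in> ?V \<and> x \<noteq> y \<and> z \<in> set (P x y)" for x y z
  have F_less: "F x y < m" if "x \<in> ?V" "y \<in> ?V" "x \<noteq> y" for x y
    using short[OF P[OF that]] by (simp add: F_def)
  have sp: "sparse_exceptions X m"
  proof
    fix x y
    have sub: "{z. X x y z} \<subseteq> set (P x y)" by (auto simp: X_def)
    then show "finite {z. X x y z}" using finite_subset by blast
    show "card {z. X x y z} \<le> m"
    proof (cases "x \<in> ?V \<and> y \<in> ?V \<and> x \<noteq> y")
      case True
      have "card {z. X x y z} \<le> card (set (P x y))" using sub by (intro card_mono) auto
      also have "\<dots> \<le> length (P x y)" by (rule card_length)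
      also have "\<dots> \<le> m" using F_less[of x y] True by (simp add: F_def)
      finally show ?thesis .
    next
      case False
      then have "{z. X x y z} = {}" by (auto simp: X_def)
      then show ?thesis by simp
    qed
  qed
  interpret sparse_exceptions X m by (rule sp)
  have inc: "F x y < F y z"
    if "(x, y, z) \<in> edges G" "x \<in> ?V" "y \<in> ?V" "z \<in> ?V" "x \<noteq> y" "y \<noteq> z" "x \<noteq> z" "\<not> X x y z" for x y z
  proof -
    have "set (P x y @ [x, y]) \<inter> {z} = {}" using that unfolding X_def by simp
    then have "tight_list G ((P x y @ [x]) @ [y, z])"
      by (intro tight_list_extend P that) simp_all
    then have "length (P x y @ [x]) \<le> length (P y z)" by (intro P_max that)
    then show ?thesis by (simp add: F_def)
  qed
  have "colored ?V F m 0"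
    unfolding colored_def
  proof (intro conjI ballI impI)
    show "finite ?V" by (rule finV)
    fix x assume x: "x \<in> ?V"
    have "{y \<in> ?V. y \<noteq> x \<and> \<not> (F x y < m \<and> F y x < m)} = {}" using F_less[OF x] F_less[OF _ x] by blast
    then show "card {y \<in> ?V. y \<noteq> x \<and> \<not> (F x y < m \<and> F y x < m)} \<le> 0" by (simp only: card.empty)
    fix y z
    assume yz: "y \<in> ?V" "z \<in> ?V"
      and h: "x \<noteq> y \<and> y \<noteq> z \<and> x \<noteq> z \<and> \<not> bad x y z \<and> F x y < m \<and> F y x < m \<and>
        F y z < m \<and> F z y < m \<and> F x z < m \<and> F z x < m"
    let ?E = "edges G"
    have d: "x \<noteq> y" "y \<noteq> z" "x \<noteq> z" and nb: "\<not> bad x y z" using h by blast+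
    have nX: "\<not> X x y z" "\<not> X y z x" "\<not> X z x y" "\<not> X x z y" "\<not> X z y x" "\<not> X y x z"
      using nb unfolding bad_def by blast+
    note d' = d d[symmetric]
    have i1: "(x, y, z) \<in> ?E \<Longrightarrow> F x y < F y z" "(y, z, x) \<in> ?E \<Longrightarrow> F y z < F z x"
      "(z, x, y) \<in> ?E \<Longrightarrow> F z x < F x y"
      by (erule inc; fact x yz d' nX)+
    have i2: "(x, z, y) \<in> ?E \<Longrightarrow> F x z < F z y" "(z, y, x) \<in> ?E \<Longrightarrow> F z y < F y x"
      "(y, x, z) \<in> ?E \<Longrightarrow> F y x < F x z"
      by (erule inc; fact x yz d' nX)+
    have "card {x, y, z} = 3" using d by simp
    then have "card (?E \<inter> orderings3 {x, y, z}) = 4"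
      using T x yz by (simp add: tournament3_def)
    then have four: "of_bool ((x, y, z) \<in> ?E) + of_bool ((y, z, x) \<in> ?E) + of_bool ((z, x, y) \<in> ?E) +
      of_bool ((x, z, y) \<in> ?E) + of_bool ((z, y, x) \<in> ?E) + of_bool ((y, x, z) \<in> ?E) = (4 :: nat)"
      using card_edges_orderings3[of x y z ?E] d by simp
    \<comment> \<open>Three edges in one cyclic class would give
      \<open>F x y < F y z < F z x < F x y\<close>.\<close>
    have n1: "\<not> ((x, y, z) \<in> ?E \<and> (y, z, x) \<in> ?E \<and> (z, x, y) \<in> ?E)"
      using i1 by (metis less_trans less_irrefl)
    have n2: "\<not> ((x, z, y) \<in> ?E \<and> (z, y, x) \<in> ?E \<and> (y, x, z) \<in> ?E)"
      using i2 by (metis less_trans less_irrefl)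
    \<comment> \<open>Four edges over two classes with at most two each leave exactly two in this
      class; the two inequalities they give form a chain, which is the cyclic order.\<close>
    have "(x, y, z) \<in> ?E \<and> (y, z, x) \<in> ?E \<or> (y, z, x) \<in> ?E \<and> (z, x, y) \<in> ?E \<or> (z, x, y) \<in> ?E \<and> (x, y, z) \<in> ?E"
      using four n1 n2
      by (cases "(x, y, z) \<in> ?E"; cases "(y, z, x) \<in> ?E"; cases "(z, x, y) \<in> ?E";
          cases "(x, z, y) \<in> ?E"; cases "(z, y, x) \<in> ?E"; cases "(y, x, z) \<in> ?E"; simp)
    then show "cw (F x y) (F y z) (F z x)" using i1 unfolding cw_def by blast
  qed
  then show thesis by (rule that[OF sp])
qed

section \<open>Asymptotics and choice of the path length\<close>

text \<open>The left side has order \<open>m powr (49 / 10)\<close> times a logarithm. The limit is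
  taken without \<open>C\<close>, whose size enters only through the threshold
  \<open>1 / (\<bar>C\<bar> + 1)\<close>.\<close>

lemma eventually_color_bound_less:
  fixes C :: real
  shows "\<forall>\<^sub>F m in sequentially. C * (10000 * (ln (real m) / ln (5 / 4) + 1003) * real m + 1) * real m powr (39 / 10) < 3 * (real m - 1) ^ 5"
proof -
  have "((\<lambda>m. (10000 * (ln (real m) / ln (5 / 4) + 1003) * real m + 1) * real m powr (39 / 10) / (3 * (real m - 1) ^ 5)) \<longlongrightarrow> 0) sequentially"
    by real_asymp
  then have "\<forall>\<^sub>F m in sequentially. (10000 * (ln (real m) / ln (5 / 4) + 1003) * real m + 1) * real m powr (39 / 10) / (3 * (real m - 1) ^ 5) < 1 / (\<bar>C\<bar> + 1)"
    by (rule order_tendstoD) simp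
  then show ?thesis
    using eventually_gt_at_top[of 1]
  proof eventually_elim
    case (elim m)
    define E where "E = (10000 * (ln (real m) / ln (5 / 4) + 1003) * real m + 1) * real m powr (39 / 10)"
    have p: "0 < 3 * (real m - 1) ^ 5" using elim by simp
    have "E < 3 * (real m - 1) ^ 5 / (\<bar>C\<bar> + 1)" using elim p by (simp add: E_def field_simps)
    then have E: "(\<bar>C\<bar> + 1) * E < 3 * (real m - 1) ^ 5" by (simp add: pos_less_divide_eq mult.commute)
    have "0 \<le> E" using elim by (auto simp: E_def intro!: mult_nonneg_nonneg add_nonneg_nonneg)
    then have "C * E \<le> (\<bar>C\<bar> + 1) * E" by (intro mult_right_mono) auto
    then show ?case using E by (simp add: E_def mult.assoc)
  qed
qed

theorem theorem26:
  shows "\<exists>\<epsilon> :: nat \<Rightarrow> real. \<epsilon> \<longlonglongrightarrow> 0 \<and>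
    (\<forall>n. real (f3 n 4) \<ge> (1 - \<epsilon> n) * (real n / 3) powr (1 / 5))"
proof -
  define C :: real where "C = 4000000 ^ 1000"
  have C: "4000000 ^ i \<le> C" if "i \<le> 1000" for i
    unfolding C_def by (rule power_increasing[OF that]) simp
  obtain m0 where m0: "\<And>m. m0 \<le> m \<Longrightarrow>
      C * (10000 * (ln (real m) / ln (5 / 4) + 1003) * real m + 1) * real m powr (39 / 10) < 3 * (real m - 1) ^ 5"
    using eventually_color_bound_less[of C] unfolding eventually_sequentially by blast
  have large: "(real n / 3) powr (1 / 5) \<le> real (f3 n 4)"
    if n: "real m0 + 1 \<le> (real n / 3) powr (1 / 5)" for n
  proof -
    define r where "r = (real n / 3) powr (1 / 5)"
    \<comment> \<open>Rounding up gives \<open>m\<close> \<ge> \<open>r\<close>, while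
      \<open>m - 1 < r\<close> makes \<open>3 * (m - 1) ^ 5\<close> at most \<open>n\<close>; so for
      large \<open>n\<close> the bound holds with no error term.\<close>
    define m where "m = nat \<lceil>r\<rceil>"
    have r1: "1 \<le> r" using n by (simp add: r_def)
    have m: "r \<le> real m" "real m - 1 < r" using r1 unfolding m_def by linarith+
    have m1: "m0 \<le> m" "1 \<le> m" using m n r1 unfolding r_def[symmetric] by linarith+
    have "m \<le> f3 n 4"
    proof (rule f3_4_ge, rule ccontr)
      fix G :: "nat digraph3"
      assume G: "tournament3 4 G" "card (verts G) = n" "\<not> contains3 G (tight_path3 m)"
      obtain X F where XF: "sparse_exceptions X m" "sparse_exceptions.colored X (verts G) F m 0"
        by (rule tournament3_coloring[OF G(1,3)])
      define t where "t = ln (real m) / ln (5 / 4)"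
      \<comment> \<open>The least integer above the logarithm of \<open>m\<close> to base 5/4, as
        \<open>card_le_powr\<close> requires \<open>m < (5 / 4) ^ j\<close>.\<close>
      define j where "j = nat \<lfloor>t\<rfloor> + 1"
      have "0 \<le> t" using m1 by (simp add: t_def)
      then have j: "t < real j" "real j \<le> t + 1" unfolding j_def by linarith+
      have "ln (real m) < real j * ln (5 / 4)"
        using j(1) unfolding t_def by (simp add: pos_divide_less_eq)
      also have "\<dots> = ln ((5 / 4) ^ j)" by (simp add: ln_realpow)
      finally have "real m < (5 / 4) ^ j" using m1 by simp
      from sparse_exceptions.card_le_powr[OF XF m1(2) this C]
      have "real n \<le> C * (10000 * real (j + 1001) * real m + 1) * real m powr (39 / 10)"
        using G(2) by simp
      also have "\<dots> \<le> C * (10000 * (t + 1003) * real m + 1) * real m powr (39 / 10)"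
        using j(2) C[of 0] by (intro mult_right_mono mult_left_mono add_right_mono) auto
      also have "\<dots> < 3 * (real m - 1) ^ 5" unfolding t_def by (rule m0[OF m1(1)])
      also have "(real m - 1) ^ 5 \<le> r ^ 5" using m m1 by (intro power_mono) auto
      also have "r ^ 5 = real n / 3"
        using r1 by (cases "n = 0") (simp_all add: r_def powr_power)
      finally show False by simp
    qed
    then show ?thesis using m(1) by (simp add: r_def)
  qed
  \<comment> \<open>The value 1 makes the claim trivial for the remaining \<open>n\<close>, and is
    not taken for large \<open>n\<close>.\<close>
  define \<epsilon> :: "nat \<Rightarrow> real" where
    "\<epsilon> n = (if (real n / 3) powr (1 / 5) \<le> real (f3 n 4) then 0 else 1)" for n
  have "filterlim (\<lambda>n. (real n / 3) powr (1 / 5)) at_top sequentially" by real_asymp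
  then have "\<forall>\<^sub>F n in sequentially. real m0 + 1 \<le> (real n / 3) powr (1 / 5)"
    by (simp add: filterlim_at_top)
  then have "\<forall>\<^sub>F n in sequentially. \<epsilon> n = 0"
    by eventually_elim (use large in \<open>simp add: \<epsilon>_def\<close>)
  then have "\<epsilon> \<longlonglongrightarrow> 0" by (rule tendsto_eventually)
  moreover have "real (f3 n 4) \<ge> (1 - \<epsilon> n) * (real n / 3) powr (1 / 5)" for n
    by (simp add: \<epsilon>_def)
  ultimately show ?thesis by blast
qed

end
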